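(* Let $m\ge 2$ be an integer and let $(s_k)_{k\in\mathbb Z}$ be a sequence of complex numbers satisfying the standing assumptions (S1)–(S4) stated in the context, with characteristic polynomial $\mathcal{CP}(x)=x^m-a_mx^{m-1}-\cdots-a_2x-a_1$. Let $P(x)\in\mathbb C[x]$ be a polynomial and let $h,r$ be integers such that $h\neq 0$ and the $h$-th powers of the $m$ roots of $\mathcal{CP}(x)$ are pairwise distinct and all not equal to $1$. Then the number of tuples $(P_1(x),P_2(x),\ldots,P_{m+1}(x))\in\mathbb C[x]^{m+1}$ satisfying $$\sum_{k=1}^{n}P(k)\,s_{hk+r}=\Big[\sum_{k=1}^{m}P_k(n)\,s_{(n+k)h+r}\Big]+P_{m+1}(n)\qquad\text{for all } n\in\mathbb N$$ is exactly one.
   Context: $\mathbb N$ denotes the set of positive integers. Standing assumptions on the bi-infinite complex sequence $(s_k)_{k\in\mathbb Z}$, for a fixed integer $m\ge 2$: (S1) There are complex numbers $a_1,a_2,\ldots,a_m$ with $a_1\ne 0$ such that $s_{k+m}=a_ms_{k+m-1}+a_{m-1}s_{k+m-2}+\cdots+a_2s_{k+1}+a_1s_k$ for all $k\in\mathbb Z$. (S2) $(s_k)_{k\in\mathbb Z}$ does not satisfy any homogeneous linear recurrence relation with constant complex coefficients of degree (order) less than $m$, i.e. $m$ is the minimal degree. (S3) $s_1,s_2,\ldots,s_m$ are not simultaneously zero. (S4) The characteristic polynomial $\mathcal{CP}(x)=x^m-a_mx^{m-1}-a_{m-1}x^{m-2}-\cdots-a_2x-a_1$ has $m$ distinct roots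 in $\mathbb C$ (all nonzero, since $a_1\neq0$). *)

theory Defs
  imports Complex_Main "HOL-Computational_Algebra.Polynomial" "HOL-Library.FuncSet"
begin

text \<open>The homogeneous linear recurrence of degree \<open>d\<close> with coefficients \<open>c 1, \<dots>, c d\<close> reads
  \<open>s (k + d) = c d * s (k + d - 1) + \<dots> + c 2 * s (k + 1) + c 1 * s k\<close> for all integers \<open>k\<close>.
  Values of \<open>c\<close> outside \<open>{1..d}\<close> are irrelevant.\<close>

definition satisfies_recurrence :: "nat \<Rightarrow> (nat \<Rightarrow> complex) \<Rightarrow> (int \<Rightarrow> complex) \<Rightarrow> bool" where
  "satisfies_recurrence d c s \<longleftrightarrow>
     (\<forall>k. s (k + int d) = (\<Sum>i=1..d. c i * s (k + int i - 1)))"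

definition characteristic_poly :: "nat \<Rightarrow> (nat \<Rightarrow> complex) \<Rightarrow> complex poly" where
  "characteristic_poly d c = monom 1 d - (\<Sum>i=1..d. monom (c i) (i - 1))"

definition characteristic_roots :: "nat \<Rightarrow> (nat \<Rightarrow> complex) \<Rightarrow> complex set" where
  "characteristic_roots d c = {z. poly (characteristic_poly d c) z = 0}"

end

theory Submission
  imports Defs
begin

text \<open>
  Write \<open>s k\<close> as \<open>\<Sum>z. c z * z powi k\<close>, the sum being over the \<open>m\<close> distinct characteristic roots.
  Minimality of the order forces every \<open>c z\<close> to be nonzero: a root with coefficient \<open>0\<close> could be
  dropped, and the remaining \<open>m - 1\<close> roots would give a shorter recurrence
  (\<open>recurrence_closed_form\<close>). Along the arithmetic progression \<open>h * k + r\<close> this becomes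
  \<open>\<Sum>\<mu>. d \<mu> * \<mu> ^ k\<close> over the \<open>m\<close> distinct powers \<open>\<mu> = z powi h\<close>, which are neither \<open>0\<close> nor \<open>1\<close>,
  and still with all \<open>d \<mu>\<close> nonzero.

  Because \<open>\<mu> \<noteq> 1\<close>, there is a polynomial \<open>R \<mu>\<close> such that \<open>P k * \<mu> ^ k\<close> is the increment of
  \<open>\<mu> ^ k * R \<mu> k\<close>, so the left-hand side telescopes to
  \<open>\<Sum>\<mu>. d \<mu> * \<mu> ^ n * R \<mu> n\<close> minus a constant (\<open>sum_exponential_polynomial\<close>). The right-hand side is
  \<open>\<Sum>\<mu>. d \<mu> * \<mu> ^ n * (\<Sum>k=1..m. \<mu> ^ k * Q k n)\<close> plus \<open>Q (m + 1) n\<close>, the last term belonging to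
  the base \<open>1\<close>. Exponential polynomials with distinct nonzero bases are linearly independent
  (\<open>exponential_polynomials_independent\<close>), so coefficients may be compared base by base. As no \<open>d \<mu>\<close>
  vanishes, the identity is equivalent to fixing \<open>Q (m + 1)\<close> as a certain constant together with
  the equations \<open>\<Sum>k=1..m. \<mu> ^ k * Q k = R \<mu>\<close>. These form a square Vandermonde system with
  distinct nonzero nodes, hence have exactly one solution.
\<close>

section \<open>Lagrange basis polynomials\<close>

definition lagrange_basis :: "'a::field set \<Rightarrow> 'a \<Rightarrow> 'a poly" where
  "lagrange_basis A z = smult (inverse (\<Prod>w\<in>A - {z}. z - w)) (\<Prod>w\<in>A - {z}. [:- w, 1:])"

lemma poly_lagrange_basis:
  assumes "finite A" "z \<in> A" "w \<in> A"
  shows "poly (lagrange_basis A z) w = (if w = z then 1 else 0)"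
proof -
  have "(\<Prod>v\<in>A - {z}. z - v) \<noteq> 0" using assms by auto
  moreover have "(\<Prod>v\<in>A - {z}. w - v) = 0" if "w \<noteq> z"
    using assms that by (intro prod_zero) auto
  ultimately show ?thesis
    by (auto simp: lagrange_basis_def poly_prod)
qed

lemma lagrange_basis_nonzero: "finite A \<Longrightarrow> z \<in> A \<Longrightarrow> lagrange_basis A z \<noteq> 0"
  using poly_lagrange_basis[of A z z] by force

lemma degree_lagrange_basis:
  assumes "finite A" "z \<in> A"
  shows "degree (lagrange_basis A z) = card A - 1"
proof -
  have "(\<Prod>v\<in>A - {z}. z - v) \<noteq> 0" using assms by auto
  moreover have "degree (\<Prod>w\<in>A - {z}. [:- w, 1:]) = card (A - {z})"
    by (subst degree_prod_sum_eq) auto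
  ultimately show ?thesis
    using assms by (simp add: lagrange_basis_def)
qed

lemma sum_lagrange_basis:
  assumes "finite A" "A \<noteq> {}"
  shows "(\<Sum>z\<in>A. lagrange_basis A z) = 1"
proof (rule poly_eqI_degree)
  show "poly (\<Sum>z\<in>A. lagrange_basis A z) w = poly 1 w" if "w \<in> A" for w
    using assms that by (simp add: poly_sum poly_lagrange_basis)
  have pos: "0 < card A" using assms by (simp add: card_gt_0_iff)
  have "degree (\<Sum>z\<in>A. lagrange_basis A z) \<le> card A - 1"
    using assms by (intro degree_sum_le) (auto simp: degree_lagrange_basis)
  with pos show "degree (\<Sum>z\<in>A. lagrange_basis A z) < card A" by linarith
  from pos show "degree (1 :: 'a poly) < card A" by simp
qed

text \<open>
  Read with the shift in place of the indeterminate, this says that the basis polynomial of \<open>z\<close>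
  maps every sequence annihilated by \<open>\<Prod>w\<in>A. [:- w, 1:]\<close> to a geometric sequence of ratio \<open>z\<close>.
\<close>
lemma linear_factor_mult_lagrange_basis:
  assumes "finite A" "z \<in> A"
  obtains c where "[:- z, 1:] * lagrange_basis A z = smult c (\<Prod>w\<in>A. [:- w, 1:])"
  using prod.remove[OF assms, of "\<lambda>w. [:- w, 1:]"]
  by (metis lagrange_basis_def mult_smult_right)

section \<open>Polynomials in the shift operator\<close>

text \<open>
  The module structure on bi-infinite sequences in which the indeterminate acts as the shift
  \<open>s k \<mapsto> s (k + 1)\<close>. Recurrences satisfied by \<open>s\<close> are then annihilating polynomials.
\<close>
definition shift_action :: "'a::comm_ring_1 poly \<Rightarrow> (int \<Rightarrow> 'a) \<Rightarrow> int \<Rightarrow> 'a" where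
  "shift_action p s k = (\<Sum>i\<le>degree p. coeff p i * s (k + int i))"

lemma shift_action_bound:
  assumes "degree p \<le> N"
  shows "shift_action p s k = (\<Sum>i\<le>N. coeff p i * s (k + int i))"
  unfolding shift_action_def
  by (rule sum.mono_neutral_left) (use assms in \<open>auto simp: coeff_eq_0\<close>)

lemma shift_action_0 [simp]: "shift_action 0 s k = 0"
  by (simp add: shift_action_def)

lemma shift_action_1 [simp]: "shift_action 1 s k = s k"
  by (simp add: shift_action_def)

lemma shift_action_pCons: "shift_action (pCons a p) s k = a * s k + shift_action p s (k + 1)"
proof -
  have "shift_action (pCons a p) s k = (\<Sum>i\<le>Suc (degree p). coeff (pCons a p) i * s (k + int i))"
    by (rule shift_action_bound) (simp add: degree_pCons_le)
  also have "\<dots> = a * s k + (\<Sum>i\<le>degree p. coeff p i * s (k + int (Suc i)))"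
    by (subst sum.atMost_Suc_shift) simp
  finally show ?thesis by (simp add: shift_action_def algebra_simps)
qed

lemma shift_action_add: "shift_action (p + q) s k = shift_action p s k + shift_action q s k"
  by (subst (1 2 3) shift_action_bound[where N = "max (degree p) (degree q)"])
     (auto simp: degree_add_le_max algebra_simps sum.distrib)

lemma shift_action_smult: "shift_action (smult c p) s k = c * shift_action p s k"
  by (subst (1 2) shift_action_bound[where N = "degree p"])
     (auto simp: degree_smult_le sum_distrib_left mult.assoc)

lemma shift_action_sum: "shift_action (sum f A) s k = (\<Sum>x\<in>A. shift_action (f x) s k)"
  by (induction A rule: infinite_finite_induct) (auto simp: shift_action_add)

lemma shift_action_mult: "shift_action (p * q) s k = shift_action p (shift_action q s) k"
proof (induction p arbitrary: k)
  case (pCons a p)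
  then show ?case
    by (simp add: mult_pCons_left shift_action_add shift_action_smult shift_action_pCons)
qed simp

lemma coeff_characteristic_poly:
  "coeff (characteristic_poly d c) i
    = (if i = d then 1 else 0) - (if i < d then c (i + 1) else 0)"
proof -
  have "(\<Sum>j=1..d. coeff (monom (c j) (j - 1)) i) = (\<Sum>j=1..d. if j = i + 1 then c (i + 1) else 0)"
    by (rule sum.cong) auto
  then show ?thesis
    by (auto simp: characteristic_poly_def coeff_sum)
qed

lemma degree_characteristic_poly: "degree (characteristic_poly d c) = d"
  by (rule antisym[OF degree_le le_degree]) (auto simp: coeff_characteristic_poly)

lemma characteristic_root_nonzero:
  assumes "d > 0" "c 1 \<noteq> 0" "z \<in> characteristic_roots d c"
  shows "z \<noteq> 0"
  using assms by (auto simp: characteristic_roots_def poly_0_coeff_0 coeff_characteristic_poly)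

lemma satisfies_recurrence_iff_shift_action:
  "satisfies_recurrence d c s \<longleftrightarrow> (\<forall>k. shift_action (characteristic_poly d c) s k = 0)"
proof -
  have "shift_action (characteristic_poly d c) s k
      = s (k + int d) - (\<Sum>i=1..d. c i * s (k + int i - 1))" for k
  proof -
    have "shift_action (characteristic_poly d c) s k
        = (\<Sum>i<d. - c (i + 1) * s (k + int i)) + s (k + int d)"
      unfolding shift_action_def degree_characteristic_poly lessThan_Suc_atMost[symmetric]
      by (simp add: coeff_characteristic_poly)
    also have "(\<Sum>i<d. - c (i + 1) * s (k + int i)) = - (\<Sum>i=1..d. c i * s (k + int i - 1))"
      unfolding sum_negf[symmetric]
      by (rule sum.reindex_bij_witness[of _ "\<lambda>i. i - 1" Suc]) auto
    finally show ?thesis by simp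
  qed
  then show ?thesis by (simp add: satisfies_recurrence_def)
qed

text \<open>
  Dividing by the leading coefficient turns any nonzero annihilator, monic or not, into a
  recurrence, so minimality of the order bounds the degree of every annihilator from below.
\<close>
lemma recurrence_of_annihilator:
  assumes "q \<noteq> 0" "\<And>k. shift_action q s k = 0"
  obtains c where "satisfies_recurrence (degree q) c s"
proof
  define c where "c i = - coeff q (i - 1) / lead_coeff q" for i
  show "satisfies_recurrence (degree q) c s"
    unfolding satisfies_recurrence_def
  proof
    fix k
    have "0 = (\<Sum>i<degree q. coeff q i * s (k + int i)) + lead_coeff q * s (k + int (degree q))"
      using assms(2)[of k] unfolding shift_action_def lessThan_Suc_atMost[symmetric] by simp
    then have "s (k + int (degree q)) = - (\<Sum>i<degree q. coeff q i * s (k + int i)) / lead_coeff q"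
      using assms(1) by (simp add: field_simps add_eq_0_iff)
    also have "\<dots> = (\<Sum>i<degree q. - coeff q i / lead_coeff q * s (k + int i))"
      by (simp add: sum_divide_distrib sum_negf)
    also have "\<dots> = (\<Sum>i=1..degree q. c i * s (k + int i - 1))"
      by (rule sum.reindex_bij_witness[of _ "\<lambda>i. i - 1" Suc]) (auto simp: c_def)
    finally show "s (k + int (degree q)) = (\<Sum>i=1..degree q. c i * s (k + int i - 1))" .
  qed
qed

lemma geometric_int_sequence:
  fixes t :: "int \<Rightarrow> 'a::field"
  assumes "z \<noteq> 0" "\<And>k. t (k + 1) = z * t k"
  shows "t k = t 0 * z powi k"
proof (induction k rule: int_induct[where k = 0])
  case (step1 i)
  then show ?case using assms by (simp add: power_int_add)
next
  case (step2 i)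
  then show ?case using assms(1) assms(2)[of "i - 1"] by (simp add: power_int_diff field_simps)
qed simp

text \<open>
  The Lagrange basis polynomials sum to \<open>1\<close>, so letting them act on \<open>s\<close> splits \<open>s\<close> into components.
  Each component is killed by its linear factor \<open>[:- z, 1:]\<close>, so it is geometric. If the component
  of \<open>z\<close> vanished, the basis polynomial of \<open>z\<close>, of degree \<open>d - 1\<close>, would annihilate \<open>s\<close>,
  contradicting minimality.
\<close>
lemma recurrence_closed_form:
  assumes "d > 0" "a 1 \<noteq> 0" "satisfies_recurrence d a s"
    and min: "\<not> (\<exists>d'<d. \<exists>c. satisfies_recurrence d' c s)"
    and card: "card (characteristic_roots d a) = d"
  obtains c where "\<And>k. s k = (\<Sum>z\<in>characteristic_roots d a. c z * z powi k)"
    and "\<And>z. z \<in> characteristic_roots d a \<Longrightarrow> c z \<noteq> 0"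
proof -
  define L where "L = characteristic_roots d a"
  define p where "p = characteristic_poly d a"
  define t where "t z = shift_action (lagrange_basis L z) s" for z
  have fin: "finite L" and ne: "L \<noteq> {}"
    using card \<open>d > 0\<close> card_gt_0_iff[of L] by (auto simp: L_def)
  have nz: "z \<noteq> 0" if "z \<in> L" for z
    using that characteristic_root_nonzero[of d a] assms(1,2) by (simp add: L_def)
  have lc: "lead_coeff (\<Prod>w\<in>L. [:- w, 1:]) = 1"
    by (simp add: lead_coeff_prod)
  have deg: "degree (\<Prod>w\<in>L. [:- w, 1:]) = d"
    using card by (subst degree_prod_sum_eq) (auto simp: L_def)
  \<comment> \<open>Having \<open>d\<close> distinct roots, the monic polynomial \<open>p\<close> of degree \<open>d\<close> has only simple factors.\<close>
  have p_eq: "p = (\<Prod>w\<in>L. [:- w, 1:])"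
  proof (rule poly_eqI_degree_lead_coeff[where n = d and A = L])
    show "poly p z = poly (\<Prod>w\<in>L. [:- w, 1:]) z" if "z \<in> L" for z
    proof -
      have "poly p z = 0" using that by (simp add: p_def L_def characteristic_roots_def)
      moreover have "poly (\<Prod>w\<in>L. [:- w, 1:]) z = 0"
        unfolding poly_prod using that fin by (intro prod_zero) auto
      ultimately show ?thesis by simp
    qed
  qed (use lc deg card in \<open>auto simp: p_def L_def degree_characteristic_poly coeff_characteristic_poly\<close>)
  have p_ann: "shift_action p s k = 0" for k
    using assms(3) by (simp add: p_def satisfies_recurrence_iff_shift_action)
  have t_geom: "t z k = t z 0 * z powi k" if z: "z \<in> L" for z k
  proof (rule geometric_int_sequence)
    fix k
    obtain c where c: "[:- z, 1:] * lagrange_basis L z = smult c p"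
      unfolding p_eq using linear_factor_mult_lagrange_basis[OF fin z] .
    have "0 = shift_action ([:- z, 1:] * lagrange_basis L z) s k"
      unfolding c by (simp add: shift_action_smult p_ann)
    also have "\<dots> = t z (k + 1) - z * t z k"
      unfolding shift_action_mult t_def by (simp add: shift_action_pCons)
    finally show "t z (k + 1) = z * t z k" by simp
  qed (use nz z in auto)
  show ?thesis
  proof (rule that[of "\<lambda>z. t z 0"])
    fix k
    have "s k = shift_action (\<Sum>z\<in>L. lagrange_basis L z) s k"
      by (simp add: sum_lagrange_basis fin ne)
    also have "\<dots> = (\<Sum>z\<in>L. t z 0 * z powi k)"
      unfolding shift_action_sum t_def[symmetric] using t_geom by (intro sum.cong) blast+
    finally show "s k = (\<Sum>z\<in>characteristic_roots d a. t z 0 * z powi k)" by (simp add: L_def)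
  next
    fix z assume "z \<in> characteristic_roots d a"
    then have z: "z \<in> L" by (simp add: L_def)
    show "t z 0 \<noteq> 0"
    proof
      assume "t z 0 = 0"
      then have "shift_action (lagrange_basis L z) s k = 0" for k
        using t_geom[OF z, of k] unfolding t_def by simp
      then obtain c where "satisfies_recurrence (degree (lagrange_basis L z)) c s"
        using recurrence_of_annihilator lagrange_basis_nonzero[OF fin z] by blast
      moreover have "degree (lagrange_basis L z) < d"
        using degree_lagrange_basis[OF fin z] card \<open>d > 0\<close> by (simp add: L_def)
      ultimately show False using min by blast
    qed
  qed
qed

section \<open>Linear independence of exponential polynomials\<close>

lemma coeff_degree_pcompose_shift:
  fixes p :: "'a::idom poly"
  shows "coeff (p \<circ>\<^sub>p [:c, 1:]) (degree p) = lead_coeff p"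
    and "degree (p \<circ>\<^sub>p [:c, 1:]) = degree p"
  using lead_coeff_comp[of "[:c, 1:]" p] degree_pcompose[of p "[:c, 1:]"] by auto

lemma poly_eq_0_if_zero_at_pos_nats:
  fixes p :: "'a::field_char_0 poly"
  assumes "\<And>n. n \<ge> 1 \<Longrightarrow> poly p (of_nat n) = 0"
  shows "p = 0"
proof (rule ccontr)
  assume "p \<noteq> 0"
  then have "finite {x. poly p x = 0}" by (rule poly_roots_finite)
  then have "finite ((of_nat :: nat \<Rightarrow> 'a) ` {1..})"
    by (rule rev_finite_subset) (use assms in auto)
  moreover have "inj_on (of_nat :: nat \<Rightarrow> 'a) {1..}" by (simp add: inj_on_def)
  ultimately have "finite {1::nat..}" by (metis finite_imageD)
  then show False by (simp add: infinite_Ici)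
qed

text \<open>
  Applying \<open>E - \<nu>\<close>, with \<open>E\<close> the shift, to the relation replaces each \<open>G \<mu>\<close> by
  \<open>H \<mu> = \<mu> * G \<mu> (x + 1) - \<nu> * G \<mu> x\<close>. Its coefficient at \<open>degree (G \<mu>)\<close> is \<open>\<mu> - \<nu>\<close> times the
  leading coefficient of \<open>G \<mu>\<close>. For \<open>\<mu> = \<nu>\<close> the degree therefore drops, which drives an induction
  that removes the base \<open>\<nu>\<close>. For \<open>\<mu> \<noteq> \<nu>\<close> no information is lost: \<open>H \<mu> = 0\<close> implies \<open>G \<mu> = 0\<close>.
\<close>
lemma exponential_polynomials_independent:
  fixes G :: "'a::field_char_0 \<Rightarrow> 'a poly"
  assumes "finite A" "0 \<notin> A"
    and "\<And>n. n \<ge> 1 \<Longrightarrow> (\<Sum>\<mu>\<in>A. \<mu> ^ n * poly (G \<mu>) (of_nat n)) = 0"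
    and "\<mu> \<in> A"
  shows "G \<mu> = 0"
  using assms
proof (induction A arbitrary: G \<mu> rule: finite_induct)
  case (insert \<nu> A)
  have \<nu>: "\<nu> \<noteq> 0" and A0: "0 \<notin> A" using insert.prems by auto
  have "\<forall>\<mu>\<in>insert \<nu> A. G \<mu> = 0"
    using insert.prems(2)
    \<comment> \<open>The measure separates \<open>G \<nu> = 0\<close> from nonzero constants, which both have degree \<open>0\<close>.\<close>
  proof (induction "if G \<nu> = 0 then 0 else Suc (degree (G \<nu>))" arbitrary: G rule: less_induct)
    case less
    show ?case
    proof (cases "G \<nu> = 0")
      case True
      have "(\<Sum>\<mu>\<in>A. \<mu> ^ n * poly (G \<mu>) (of_nat n)) = 0" if "n \<ge> 1" for n
        using less.prems[OF that] True insert.hyps by simp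
      then show ?thesis using insert.IH[OF A0, of G] True by blast
    next
      case False
      define H where "H \<mu> = smult \<mu> (G \<mu> \<circ>\<^sub>p [:1, 1:]) - smult \<nu> (G \<mu>)" for \<mu>
      have coeff_H: "coeff (H \<mu>) (degree (G \<mu>)) = (\<mu> - \<nu>) * lead_coeff (G \<mu>)" for \<mu>
        by (simp add: H_def coeff_degree_pcompose_shift algebra_simps)
      have deg_H: "degree (H \<mu>) \<le> degree (G \<mu>)" for \<mu>
        unfolding H_def
        by (intro degree_diff_le order.trans[OF degree_smult_le])
           (simp_all add: coeff_degree_pcompose_shift)
      have smaller: "degree (H \<nu>) < degree (G \<nu>)" if "H \<nu> \<noteq> 0"
      proof -
        have "coeff (H \<nu>) (degree (G \<nu>)) = 0" by (simp add: coeff_H)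
        then have "degree (H \<nu>) \<noteq> degree (G \<nu>)"
          using that by (metis leading_coeff_0_iff)
        then show ?thesis using deg_H[of \<nu>] by linarith
      qed
      have "(\<Sum>\<mu>\<in>insert \<nu> A. \<mu> ^ n * poly (H \<mu>) (of_nat n)) = 0" if "n \<ge> 1" for n
      proof -
        have "(\<Sum>\<mu>\<in>insert \<nu> A. \<mu> ^ n * poly (H \<mu>) (of_nat n))
            = (\<Sum>\<mu>\<in>insert \<nu> A. \<mu> ^ Suc n * poly (G \<mu>) (of_nat (Suc n)))
              - \<nu> * (\<Sum>\<mu>\<in>insert \<nu> A. \<mu> ^ n * poly (G \<mu>) (of_nat n))"
          unfolding sum_distrib_left sum_subtractf[symmetric]
          by (rule sum.cong) (simp_all add: H_def poly_pcompose algebra_simps)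
        also have "\<dots> = 0"
          using less.prems[of "Suc n"] less.prems[of n] that by (simp del: sum.insert)
        finally show ?thesis .
      qed
      moreover have "(if H \<nu> = 0 then 0 else Suc (degree (H \<nu>)))
          < (if G \<nu> = 0 then 0 else Suc (degree (G \<nu>)))"
        using smaller False by simp
      ultimately have H0: "\<forall>\<mu>\<in>insert \<nu> A. H \<mu> = 0"
        by (intro less.hyps)
      have GA: "G \<mu> = 0" if "\<mu> \<in> A" for \<mu>
        using coeff_H[of \<mu>] H0 that insert.hyps by auto
      have "poly (G \<nu>) (of_nat n) = 0" if "n \<ge> 1" for n
        using less.prems[OF that] insert.hyps GA \<nu> by simp
      then have "G \<nu> = 0" by (rule poly_eq_0_if_zero_at_pos_nats)
      with GA show ?thesis by simp
    qed
  qed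
  with insert.prems show ?case by blast
qed simp

section \<open>Summation of exponential polynomials\<close>

text \<open>
  The operator \<open>R \<mapsto> R x - \<beta> * R (x - 1)\<close> multiplies leading coefficients by \<open>1 - \<beta> \<noteq> 0\<close>, so
  \<open>P\<close> can be matched from its top coefficient downwards.
\<close>
lemma exists_polynomial_antidifference:
  fixes P :: "'a::field poly"
  assumes "\<beta> \<noteq> 1"
  shows "\<exists>R. R - smult \<beta> (R \<circ>\<^sub>p [:- 1, 1:]) = P"
proof (induction "degree P" arbitrary: P rule: less_induct)
  case less
  define c where "c = lead_coeff P / (1 - \<beta>)"
  define T where "T = monom c (degree P)"
  define D where "D = P - (T - smult \<beta> (T \<circ>\<^sub>p [:- 1, 1:]))"
  have T: "degree T \<le> degree P" "coeff T (degree P) = c"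
    by (simp_all add: T_def degree_monom_le)
  have cT: "coeff (T \<circ>\<^sub>p [:- 1, 1:]) (degree P) = c"
  proof (cases "c = 0")
    case False
    then have "degree T = degree P" by (simp add: T_def degree_monom_eq)
    then show ?thesis using coeff_degree_pcompose_shift(1)[of T "- 1"] T by simp
  qed (simp add: T_def)
  have "degree D \<le> degree P"
    unfolding D_def using T(1)
    by (intro degree_diff_le order.trans[OF degree_smult_le])
       (simp_all add: coeff_degree_pcompose_shift)
  moreover have "c - \<beta> * c = lead_coeff P"
  proof -
    have "c * (1 - \<beta>) = lead_coeff P" using assms by (simp add: c_def)
    then show ?thesis by (simp add: algebra_simps)
  qed
  then have "coeff D (degree P) = 0"
    by (simp add: D_def T(2) cT)
  ultimately have D: "degree D < degree P \<or> D = 0"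
    by (metis le_neq_implies_less leading_coeff_0_iff)
  have "\<exists>R. R - smult \<beta> (R \<circ>\<^sub>p [:- 1, 1:]) = D"
  proof (cases "D = 0")
    case True
    then show ?thesis by (intro exI[of _ 0]) simp
  next
    case False
    then show ?thesis using less.hyps D by blast
  qed
  then obtain R where "R - smult \<beta> (R \<circ>\<^sub>p [:- 1, 1:]) = D" by blast
  then have "(R + T) - smult \<beta> ((R + T) \<circ>\<^sub>p [:- 1, 1:]) = P"
    unfolding D_def pcompose_add smult_add_right by (simp add: algebra_simps)
  then show ?case by blast
qed

lemma sum_exponential_polynomial:
  fixes \<mu> :: "'a::field"
  assumes "\<mu> \<noteq> 0" and R: "R - smult (inverse \<mu>) (R \<circ>\<^sub>p [:- 1, 1:]) = P"
  shows "(\<Sum>k=1..n. poly P (of_nat k) * \<mu> ^ k) = \<mu> ^ n * poly R (of_nat n) - poly R 0"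
proof (induction n)
  case (Suc n)
  have "poly P (of_nat (Suc n)) = poly R (of_nat (Suc n)) - inverse \<mu> * poly R (of_nat n)"
    by (simp add: R[symmetric] poly_pcompose)
  then have "poly P (of_nat (Suc n)) * \<mu> ^ Suc n
      = \<mu> ^ Suc n * poly R (of_nat (Suc n)) - (\<mu> ^ Suc n * inverse \<mu>) * poly R (of_nat n)"
    by (simp only: left_diff_distrib right_diff_distrib mult_ac)
  moreover have "\<mu> ^ Suc n * inverse \<mu> = \<mu> ^ n" using assms(1) by simp
  ultimately show ?case using Suc by simp
qed simp

section \<open>Vandermonde systems with polynomial unknowns\<close>

text \<open>
  The inverse of the Vandermonde matrix with exponents \<open>1, \<dots>, card M\<close> consists of coefficients of
  the Lagrange basis. Adjoining the node \<open>0\<close> makes the basis polynomials of the other nodes vanish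
  at \<open>0\<close>, so their constant coefficient disappears and the exponents start at \<open>1\<close>.
\<close>
lemma vandermonde_solution_exists:
  fixes R :: "'a::field \<Rightarrow> 'a poly"
  assumes fin: "finite M" and "0 \<notin> M"
  obtains V where "\<And>\<mu>. \<mu> \<in> M \<Longrightarrow> (\<Sum>k=1..card M. smult (\<mu> ^ k) (V k)) = R \<mu>"
proof
  define l where "l = lagrange_basis (insert 0 M)"
  define V where "V k = (\<Sum>\<nu>\<in>M. smult (coeff (l \<nu>) k) (R \<nu>))" for k
  fix \<mu> assume \<mu>: "\<mu> \<in> M"
  have l: "(\<Sum>k=1..card M. \<mu> ^ k * coeff (l \<nu>) k) = (if \<mu> = \<nu> then 1 else 0)" if "\<nu> \<in> M" for \<nu>
  proof -
    have deg: "degree (l \<nu>) = card M"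
      using assms that by (simp add: l_def degree_lagrange_basis)
    have "poly (l \<nu>) 0 = 0"
      using assms that by (auto simp: l_def poly_lagrange_basis)
    then have c0: "coeff (l \<nu>) 0 = 0" by (simp add: poly_0_coeff_0)
    have "(if \<mu> = \<nu> then 1 else 0) = poly (l \<nu>) \<mu>"
      using assms that \<mu> by (simp add: l_def poly_lagrange_basis)
    also have "\<dots> = (\<Sum>k\<in>insert 0 {1..card M}. coeff (l \<nu>) k * \<mu> ^ k)"
      unfolding poly_altdef deg by (rule sum.cong) auto
    also have "\<dots> = (\<Sum>k=1..card M. coeff (l \<nu>) k * \<mu> ^ k)"
      using c0 by simp
    finally show ?thesis by (simp add: mult.commute)
  qed
  have "(\<Sum>k=1..card M. smult (\<mu> ^ k) (V k))
      = (\<Sum>k=1..card M. \<Sum>\<nu>\<in>M. smult (\<mu> ^ k * coeff (l \<nu>) k) (R \<nu>))"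
    by (intro poly_eqI) (simp add: V_def coeff_sum sum_distrib_left mult.assoc)
  also have "\<dots> = (\<Sum>\<nu>\<in>M. smult (\<Sum>k=1..card M. \<mu> ^ k * coeff (l \<nu>) k) (R \<nu>))"
    by (subst sum.swap) (intro poly_eqI, simp add: coeff_sum sum_distrib_right)
  also have "\<dots> = (\<Sum>\<nu>\<in>M. if \<mu> = \<nu> then R \<nu> else 0)"
    by (rule sum.cong) (auto simp: l simp del: One_nat_def)
  also have "\<dots> = R \<mu>" using fin \<mu> by simp
  finally show "(\<Sum>k=1..card M. smult (\<mu> ^ k) (V k)) = R \<mu>" .
qed

text \<open>
  Fix a coefficient index \<open>i\<close>. The differences of the \<open>i\<close>-th coefficients are themselves the
  coefficients of a polynomial \<open>f\<close> of degree at most \<open>card M\<close>. It vanishes on \<open>M\<close>, and also at \<open>0\<close>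
  because the exponents start at \<open>1\<close>; these are too many roots.
\<close>
lemma vandermonde_solution_unique:
  fixes V W :: "nat \<Rightarrow> 'a::field poly"
  assumes "finite M" "0 \<notin> M"
    and eq: "\<And>\<mu>. \<mu> \<in> M \<Longrightarrow>
      (\<Sum>k=1..card M. smult (\<mu> ^ k) (V k)) = (\<Sum>k=1..card M. smult (\<mu> ^ k) (W k))"
    and k: "k \<in> {1..card M}"
  shows "V k = W k"
proof (rule poly_eqI)
  fix i
  define f where "f = (\<Sum>j=1..card M. monom (coeff (V j) i - coeff (W j) i) j)"
  have "f = 0"
  proof (rule poly_eqI_degree[where A = "insert 0 M"])
    fix \<mu> assume "\<mu> \<in> insert 0 M"
    moreover have "poly f 0 = 0" by (simp add: f_def poly_sum poly_monom)
    moreover have "poly f \<mu> = 0" if "\<mu> \<in> M"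
    proof -
      have "poly f \<mu> = coeff (\<Sum>j=1..card M. smult (\<mu> ^ j) (V j)) i
          - coeff (\<Sum>j=1..card M. smult (\<mu> ^ j) (W j)) i"
        by (simp add: f_def poly_sum poly_monom coeff_sum sum_subtractf algebra_simps)
      then show ?thesis unfolding eq[OF that] by simp
    qed
    ultimately show "poly f \<mu> = poly 0 \<mu>" by auto
  next
    have "degree f \<le> card M"
      unfolding f_def by (intro degree_sum_le order.trans[OF degree_monom_le]) auto
    then show "degree f < card (insert 0 M)" using assms(1,2) by simp
  qed (use assms(1) in \<open>simp add: card_gt_0_iff\<close>)
  then have "coeff f k = 0" by simp
  moreover have "coeff f k = coeff (V k) i - coeff (W k) i"
    using k by (simp add: f_def coeff_sum)
  ultimately show "coeff (V k) i = coeff (W k) i" by simp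
qed

section \<open>Uniqueness of the summation polynomials\<close>

text \<open>
  The uniqueness statement for a sequence given in closed form. The heart is the equivalence \<open>key\<close>:
  by linear independence over the bases \<open>insert 1 M\<close>, the summation identity for all \<open>n \<ge> 1\<close> is a
  Vandermonde system for \<open>Q 1, \<dots>, Q (card M)\<close> together with a prescribed constant for the last
  polynomial.
\<close>
lemma unique_summation_polynomials:
  fixes P :: "'a::field_char_0 poly" and M :: "'a set" and d :: "'a \<Rightarrow> 'a" and u :: "nat \<Rightarrow> 'a"
  assumes fin: "finite M" and M0: "0 \<notin> M" and M1: "1 \<notin> M"
    and d: "\<And>\<mu>. \<mu> \<in> M \<Longrightarrow> d \<mu> \<noteq> 0"
    and u: "\<And>k. u k = (\<Sum>\<mu>\<in>M. d \<mu> * \<mu> ^ k)"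
  shows "\<exists>!Q. Q \<in> {1..card M + 1} \<rightarrow>\<^sub>E (UNIV :: 'a poly set) \<and>
    (\<forall>n\<ge>1. (\<Sum>k=1..n. poly P (of_nat k) * u k)
      = (\<Sum>k=1..card M. poly (Q k) (of_nat n) * u (n + k)) + poly (Q (card M + 1)) (of_nat n))"
proof -
  let ?m = "card M"
  have "\<exists>R. R - smult (inverse \<mu>) (R \<circ>\<^sub>p [:- 1, 1:]) = P" if "\<mu> \<in> M" for \<mu>
    using that M1 by (intro exists_polynomial_antidifference) (auto simp: inverse_eq_1_iff)
  then obtain R where R: "\<And>\<mu>. \<mu> \<in> M \<Longrightarrow> R \<mu> - smult (inverse \<mu>) (R \<mu> \<circ>\<^sub>p [:- 1, 1:]) = P"
    by metis
  define C where "C = (\<Sum>\<mu>\<in>M. d \<mu> * poly (R \<mu>) 0)"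
  define V where "V Q \<mu> = (\<Sum>k=1..?m. smult (\<mu> ^ k) (Q k))" for Q :: "nat \<Rightarrow> 'a poly" and \<mu>
  have lhs: "(\<Sum>k=1..n. poly P (of_nat k) * u k)
      = (\<Sum>\<mu>\<in>M. \<mu> ^ n * poly (smult (d \<mu>) (R \<mu>)) (of_nat n)) - C" for n
  proof -
    have "(\<Sum>k=1..n. poly P (of_nat k) * u k)
        = (\<Sum>k=1..n. \<Sum>\<mu>\<in>M. d \<mu> * (poly P (of_nat k) * \<mu> ^ k))"
      by (simp add: u sum_distrib_left mult.left_commute)
    also have "\<dots> = (\<Sum>\<mu>\<in>M. d \<mu> * (\<Sum>k=1..n. poly P (of_nat k) * \<mu> ^ k))"
      by (subst sum.swap) (simp add: sum_distrib_left)
    also have "\<dots> = (\<Sum>\<mu>\<in>M. d \<mu> * (\<mu> ^ n * poly (R \<mu>) (of_nat n) - poly (R \<mu>) 0))"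
    proof (rule sum.cong)
      fix \<mu> assume \<mu>: "\<mu> \<in> M"
      with M0 have "\<mu> \<noteq> 0" by auto
      then show "d \<mu> * (\<Sum>k=1..n. poly P (of_nat k) * \<mu> ^ k)
          = d \<mu> * (\<mu> ^ n * poly (R \<mu>) (of_nat n) - poly (R \<mu>) 0)"
        using sum_exponential_polynomial[OF _ R[OF \<mu>]] by simp
    qed simp
    finally show ?thesis
      by (simp add: C_def sum_subtractf right_diff_distrib mult.left_commute)
  qed
  have rhs: "(\<Sum>k=1..?m. poly (Q k) (of_nat n) * u (n + k))
      = (\<Sum>\<mu>\<in>M. \<mu> ^ n * poly (smult (d \<mu>) (V Q \<mu>)) (of_nat n))" for Q :: "nat \<Rightarrow> 'a poly" and n
  proof -
    have "(\<Sum>k=1..?m. poly (Q k) (of_nat n) * u (n + k))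
        = (\<Sum>k=1..?m. \<Sum>\<mu>\<in>M. \<mu> ^ n * (d \<mu> * (\<mu> ^ k * poly (Q k) (of_nat n))))"
      by (simp add: u sum_distrib_left power_add mult_ac)
    then show ?thesis
      by (subst (asm) sum.swap) (simp add: V_def poly_sum sum_distrib_left)
  qed
  have key: "(\<forall>n\<ge>1. (\<Sum>k=1..n. poly P (of_nat k) * u k)
        = (\<Sum>k=1..?m. poly (Q k) (of_nat n) * u (n + k)) + poly (Q (?m + 1)) (of_nat n))
      \<longleftrightarrow> (\<forall>\<mu>\<in>M. V Q \<mu> = R \<mu>) \<and> Q (?m + 1) = [:- C:]" (is "?L Q \<longleftrightarrow> ?R Q") for Q
  proof
    assume L: "?L Q"
    \<comment> \<open>The constant from the telescoping belongs to the base \<open>1\<close>, which lies outside \<open>M\<close>.\<close>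
    define G where "G \<mu> = (if \<mu> = 1 then Q (?m + 1) + [:C:] else smult (d \<mu>) (V Q \<mu> - R \<mu>))" for \<mu>
    have "(\<Sum>\<mu>\<in>insert 1 M. \<mu> ^ n * poly (G \<mu>) (of_nat n)) = 0" if "n \<ge> 1" for n
    proof -
      have "(\<Sum>\<mu>\<in>M. \<mu> ^ n * poly (G \<mu>) (of_nat n))
          = (\<Sum>\<mu>\<in>M. \<mu> ^ n * poly (smult (d \<mu>) (V Q \<mu>)) (of_nat n))
            - (\<Sum>\<mu>\<in>M. \<mu> ^ n * poly (smult (d \<mu>) (R \<mu>)) (of_nat n))"
        unfolding sum_subtractf[symmetric]
        by (rule sum.cong) (use M1 in \<open>auto simp: G_def algebra_simps\<close>)
      moreover have "poly (G 1) (of_nat n) = poly (Q (?m + 1)) (of_nat n) + C"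
        by (simp add: G_def)
      moreover have "(\<Sum>\<mu>\<in>M. \<mu> ^ n * poly (smult (d \<mu>) (R \<mu>)) (of_nat n)) - C
          = (\<Sum>\<mu>\<in>M. \<mu> ^ n * poly (smult (d \<mu>) (V Q \<mu>)) (of_nat n))
            + poly (Q (?m + 1)) (of_nat n)"
        using L that unfolding lhs rhs by blast
      ultimately show ?thesis using fin M1 by (simp add: algebra_simps)
    qed
    then have G: "G \<mu> = 0" if "\<mu> \<in> insert 1 M" for \<mu>
      using exponential_polynomials_independent[of "insert 1 M" G \<mu>] fin M0 that by simp
    have "V Q \<mu> = R \<mu>" if "\<mu> \<in> M" for \<mu>
      using G[of \<mu>] d[OF that] that M1 by (auto simp: G_def split: if_splits)
    moreover have "Q (?m + 1) = [:- C:]"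
      using G[of 1] eq_neg_iff_add_eq_0[of "Q (?m + 1)" "[:C:]"] by (simp add: G_def)
    ultimately show "?R Q" by blast
  next
    assume "?R Q"
    then show "?L Q" unfolding lhs rhs by simp
  qed
  obtain W where W: "\<And>\<mu>. \<mu> \<in> M \<Longrightarrow> V W \<mu> = R \<mu>"
    using vandermonde_solution_exists[OF fin M0, of R] unfolding V_def by blast
  define Q where "Q = restrict (W(?m + 1 := [:- C:])) {1..?m + 1}"
  have VQ: "V Q \<mu> = V W \<mu>" for \<mu>
    unfolding V_def by (rule sum.cong) (auto simp: Q_def)
  show ?thesis
    unfolding key
  proof (rule ex1I[of _ Q])
    show "Q \<in> {1..?m + 1} \<rightarrow>\<^sub>E UNIV \<and> (\<forall>\<mu>\<in>M. V Q \<mu> = R \<mu>) \<and> Q (?m + 1) = [:- C:]"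
      using VQ W by (auto simp: Q_def)
  next
    fix Q'
    assume Q': "Q' \<in> {1..?m + 1} \<rightarrow>\<^sub>E UNIV \<and> (\<forall>\<mu>\<in>M. V Q' \<mu> = R \<mu>) \<and> Q' (?m + 1) = [:- C:]"
    have "V Q' \<mu> = V Q \<mu>" if "\<mu> \<in> M" for \<mu>
      using Q' VQ W that by simp
    then have eq: "Q' k = Q k" if "k \<in> {1..?m}" for k
      using vandermonde_solution_unique[OF fin M0 _ that] unfolding V_def by blast
    show "Q' = Q"
    proof (rule PiE_ext)
      show "Q' \<in> {1..?m + 1} \<rightarrow>\<^sub>E UNIV" using Q' by blast
      show "Q \<in> {1..?m + 1} \<rightarrow>\<^sub>E UNIV" by (simp add: Q_def)
      fix k assume "k \<in> {1..?m + 1}"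
      then consider "k \<in> {1..?m}" | "k = ?m + 1" by fastforce
      then show "Q' k = Q k" using eq Q' by cases (auto simp: Q_def)
    qed
  qed
qed

section \<open>Sums along arithmetic progressions of a recurrent sequence\<close>

lemma card_eq_1_if_ex1:
  assumes "\<exists>!x. x \<in> A \<and> p x"
  shows "card {x \<in> A. p x} = 1"
proof -
  obtain x where "x \<in> A" "p x" and "\<And>y. y \<in> A \<Longrightarrow> p y \<Longrightarrow> y = x"
    using assms by metis
  then have "{x \<in> A. p x} = {x}" by blast
  then show ?thesis by simp
qed

theorem theorem1p3:
  fixes m :: nat and s :: "int \<Rightarrow> complex" and a :: "nat \<Rightarrow> complex"
    and P :: "complex poly" and h r :: int
  assumes m: "m \<ge> 2"
    and S1: "a 1 \<noteq> 0" "satisfies_recurrence m a s"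
    and S2: "\<not> (\<exists>d<m. \<exists>c. satisfies_recurrence d c s)"
    and S3: "\<exists>i\<in>{1..m}. s (int i) \<noteq> 0"
    and S4: "card (characteristic_roots m a) = m"
    and h: "h \<noteq> 0"
    and powers_distinct: "inj_on (\<lambda>z. z powi h) (characteristic_roots m a)"
    and powers_not_one: "\<forall>z\<in>characteristic_roots m a. z powi h \<noteq> 1"
  shows "card {Q \<in> {1..m+1} \<rightarrow>\<^sub>E (UNIV :: complex poly set).
           \<forall>n::nat. n \<ge> 1 \<longrightarrow>
             (\<Sum>k=1..n. poly P (of_nat k) * s (h * int k + r)) =
             (\<Sum>k=1..m. poly (Q k) (of_nat n) * s ((int n + int k) * h + r))
               + poly (Q (m+1)) (of_nat n)} = 1"
proof -
  define L where "L = characteristic_roots m a"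
  define M where "M = (\<lambda>z. z powi h) ` L"
  define root where "root = the_inv_into L (\<lambda>z. z powi h)"
  have inj: "inj_on (\<lambda>z. z powi h) L" using powers_distinct by (simp add: L_def)
  obtain c where c: "\<And>k. s k = (\<Sum>z\<in>L. c z * z powi k)" "\<And>z. z \<in> L \<Longrightarrow> c z \<noteq> 0"
    using recurrence_closed_form[of m a s] m S1 S2 S4 unfolding L_def by auto
  have fin: "finite L" using S4 m by (intro card_ge_0_finite) (simp add: L_def)
  have nz: "z \<noteq> 0" if "z \<in> L" for z
    using that characteristic_root_nonzero[of m a] m S1 by (simp add: L_def)
  have root: "root (z powi h) = z" if "z \<in> L" for z
    using the_inv_into_f_f[OF inj that] by (simp add: root_def)
  define d where "d \<mu> = c (root \<mu>) * root \<mu> powi r" for \<mu>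
  have s_eq: "s (h * int k + r) = (\<Sum>\<mu>\<in>M. d \<mu> * \<mu> ^ k)" for k
  proof -
    have "(\<Sum>\<mu>\<in>M. d \<mu> * \<mu> ^ k) = (\<Sum>z\<in>L. c z * z powi r * (z powi h) ^ k)"
      unfolding M_def by (subst sum.reindex[OF inj]) (simp add: d_def root)
    also have "\<dots> = s (h * int k + r)"
      unfolding c(1)
      by (rule sum.cong) (simp_all add: nz power_int_add power_int_mult)
    finally show ?thesis ..
  qed
  have cardM: "card M = m" using S4 card_image[OF inj] by (simp add: M_def L_def)
  have "\<exists>!Q. Q \<in> {1..card M + 1} \<rightarrow>\<^sub>E (UNIV :: complex poly set) \<and>
    (\<forall>n\<ge>1. (\<Sum>k=1..n. poly P (of_nat k) * s (h * int k + r))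
      = (\<Sum>k=1..card M. poly (Q k) (of_nat n) * s (h * int (n + k) + r))
        + poly (Q (card M + 1)) (of_nat n))"
  proof (rule unique_summation_polynomials)
    show "finite M" using fin by (simp add: M_def)
    show "0 \<notin> M" using nz by (auto simp: M_def)
    show "1 \<notin> M" using powers_not_one by (auto simp: M_def L_def)
    show "d \<mu> \<noteq> 0" if "\<mu> \<in> M" for \<mu>
      using that c(2) nz by (auto simp: M_def d_def root)
  qed (rule s_eq)
  then show ?thesis
    unfolding cardM of_nat_add mult.commute[of h "int _ + int _"]
    by (rule card_eq_1_if_ex1)
qed

end
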